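(* Let $\Upsilon_1,\dots,\Upsilon_d$ be partially ordered sets with orders $\preceq_1,\dots,\preceq_d$, and let $\phi:\prod_{i=1}^d\Upsilon_i\to\mathbb{R}$ have increasing differences. For each $i\in\{1,\dots,d\}$ let $(\upsilon_{ij},\alpha_{ij})_{j=0}^n$ be pairs of elements of $\Upsilon_i$ with $$\alpha_{i0}\preceq_i\cdots\preceq_i\alpha_{in},\quad \upsilon_{i0}=\alpha_{i0},\quad \upsilon_{ij}\preceq_i\upsilon_{in}\ \text{and}\ \upsilon_{ij}\preceq_i\alpha_{ij}\ \text{ for } j\in\{1,\dots,n\}.$$ Suppose that for each $i\in\{1,\dots,d\}$ there exist elements $(\tilde\upsilon_{ij})_{j=0}^n$ of $\Upsilon_i$ with $$\tilde\upsilon_{i0}\preceq_i\cdots\preceq_i\tilde\upsilon_{in}=\upsilon_{in}\quad\text{and}\quad\upsilon_{ij}\preceq_i\tilde\upsilon_{ij}\preceq_i\alpha_{ij}\ \text{ for } j\in\{0,\dots,n\}.$$ Then, for each direction vector (staircase) $\omega$ in the grid $\{0,1,\dots,n\}^d$, $$\phi(\upsilon_{1n},\dots,\upsilon_{dn})\le\mathcal{B}^\omega(\phi)(\upsilon,\alpha).$$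
   Context: For posets $X,T$, $f:X\times T\to\mathbb{R}$ has increasing differences in $(x,t)$ if for $x'\succeq x$ the map $t\mapsto f(x',t)-f(x,t)$ is monotone non-decreasing. $\phi:\prod_i\Upsilon_i\to\mathbb{R}$ has increasing differences if for all distinct $i',i''$ and all fixed values of the other coordinates, $\phi$ has increasing differences in the pair of coordinates $(i',i'')$. A direction vector in $\{0,\dots,n\}^d$ is $\omega\in\{1,\dots,d\}^{dn}$ in which each $i$ occurs exactly $n$ times; it defines the staircase $p^0=0$, $p^t=p^{t-1}+e_{\omega_t}$, $t=1,\dots,dn$. For a family $v=(v_{ij})$ with $v_{ij}\in\Upsilon_i$ and $p\in\{0,\dots,n\}^d$, $\Pi(v;p)=(v_{1p_1},\dots,v_{dp_d})$. $(\alpha_{-i},\upsilon_i)$ denotes $\alpha$ with its $i$-th block $(\alpha_{ij})_j$ replaced by $(\upsilon_{ij})_j$. Then $$\mathcal{B}^\omega(\phi)(\upsilon,\alpha)=\phi(\alpha_{10},\dots,\alpha_{d0})+\sum_{t=1}^{dn}\Bigl[\phi\bigl(\Pi((\alpha_{-\omega_t},\upsilon_{\omega_t});p^t)\bigr)-\phi\bigl(\Pi((\alpha_{-\omega_t},\upsilon_{\omega_t});p^{t-1})\bigr)\Bigr].$$ *)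

theory Defs
  imports Complex_Main "HOL-Library.FuncSet"
begin

(* A poset is a carrier set X with an order relation r satisfying partial_order_on X r. *)

definition increasing_differences ::
  "'x set \<Rightarrow> 'x rel \<Rightarrow> 't set \<Rightarrow> 't rel \<Rightarrow> ('x \<times> 't \<Rightarrow> real) \<Rightarrow> bool" where
  "increasing_differences X rX T rT f \<longleftrightarrow>
     (\<forall>x\<in>X. \<forall>x'\<in>X. (x, x') \<in> rX \<longrightarrow>
        monotone_on T (\<lambda>s t. (s, t) \<in> rT) (\<le>) (\<lambda>t. f (x', t) - f (x, t)))"

(* The product of U 1, ..., U d is the extensional product PiE {1..d} U; the factors, which
   need not be related to each other, are carrier sets in a common type. The point z supplies
   the fixed values of the coordinates other than i' and i''. *)
definition increasing_differences_prod ::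
  "nat \<Rightarrow> (nat \<Rightarrow> 'a set) \<Rightarrow> (nat \<Rightarrow> 'a rel) \<Rightarrow> ((nat \<Rightarrow> 'a) \<Rightarrow> real) \<Rightarrow> bool" where
  "increasing_differences_prod d U r \<phi> \<longleftrightarrow>
     (\<forall>i'\<in>{1..d}. \<forall>i''\<in>{1..d}. i' \<noteq> i'' \<longrightarrow>
        (\<forall>z \<in> (\<Pi>\<^sub>E i\<in>{1..d}. U i).
           increasing_differences (U i') (r i') (U i'') (r i'')
             (\<lambda>(x, t). \<phi> (z(i' := x, i'' := t)))))"

definition direction_vector :: "nat \<Rightarrow> nat \<Rightarrow> (nat \<Rightarrow> nat) \<Rightarrow> bool" where
  "direction_vector d n \<omega> \<longleftrightarrow>
     \<omega> \<in> {1..d * n} \<rightarrow>\<^sub>E {1..d} \<and> (\<forall>i\<in>{1..d}. card {t \<in> {1..d * n}. \<omega> t = i} = n)"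

primrec staircase :: "(nat \<Rightarrow> nat) \<Rightarrow> nat \<Rightarrow> (nat \<Rightarrow> nat)" where
  "staircase \<omega> 0 = (\<lambda>i. 0)"
| "staircase \<omega> (Suc t) =
     (staircase \<omega> t)(\<omega> (Suc t) := staircase \<omega> t (\<omega> (Suc t)) + 1)"

definition grid_point :: "nat \<Rightarrow> (nat \<Rightarrow> nat \<Rightarrow> 'a) \<Rightarrow> (nat \<Rightarrow> nat) \<Rightarrow> (nat \<Rightarrow> 'a)" where
  "grid_point d v p = (\<lambda>i\<in>{1..d}. v i (p i))"

(* A family (v_ij) is a function v with v i j = v_ij, so v(i := w i) replaces the i-th block
   of v by that of w. *)
definition staircase_bound ::
  "nat \<Rightarrow> nat \<Rightarrow> (nat \<Rightarrow> nat) \<Rightarrow> ((nat \<Rightarrow> 'a) \<Rightarrow> real) \<Rightarrow>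
   (nat \<Rightarrow> nat \<Rightarrow> 'a) \<Rightarrow> (nat \<Rightarrow> nat \<Rightarrow> 'a) \<Rightarrow> real" where
  "staircase_bound d n \<omega> \<phi> \<upsilon> \<alpha> =
     \<phi> (\<lambda>i\<in>{1..d}. \<alpha> i 0) +
     (\<Sum>t = 1..d * n.
        \<phi> (grid_point d (\<alpha>(\<omega> t := \<upsilon> (\<omega> t))) (staircase \<omega> t)) -
        \<phi> (grid_point d (\<alpha>(\<omega> t := \<upsilon> (\<omega> t))) (staircase \<omega> (t - 1))))"

end

theory Submission
  imports Defs
begin

text \<open>
  Write \<open>w\<close> for the monotone chains that lie between \<open>\<upsilon>\<close> and \<open>\<alpha>\<close>, and let \<open>p\<close> move along the
  staircase. The potential
  \<open>E(p) = \<Sum>i. \<phi>(\<Pi>((\<alpha>\<^sub>-\<^sub>i, w\<^sub>i); p)) - \<phi>(\<Pi>((\<alpha>\<^sub>-\<^sub>i, \<upsilon>\<^sub>i); p))\<close> vanishes at both ends of the staircase,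
  and \<open>\<phi>(\<Pi>(w; p)) \<le> B(p) + E(p)\<close> is preserved by each step, where \<open>B(p)\<close> is the partial sum of the
  bound up to \<open>p\<close>. In a step in direction \<open>k\<close>, increasing differences let one replace \<open>w\<^sub>i\<close> by
  \<open>\<alpha>\<^sub>i\<close> for \<open>i \<noteq> k\<close> in the increment of the left-hand side; the increments of \<open>B\<close> and of the
  \<open>k\<close>-th term of \<open>E\<close> add up to exactly the resulting quantity, and the other terms of \<open>E\<close> do not
  decrease because \<open>\<upsilon>\<^sub>i \<preceq> w\<^sub>i\<close> and \<open>\<alpha>\<^sub>k\<close> increases.
\<close>

lemma increasing_differences_prodD:
  assumes "increasing_differences_prod d U r \<phi>"
    and "i \<in> {1..d}" "k \<in> {1..d}" "i \<noteq> k" "z \<in> (\<Pi>\<^sub>E i\<in>{1..d}. U i)"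
    and "x \<in> U i" "x' \<in> U i" "(x, x') \<in> r i"
    and "s \<in> U k" "t \<in> U k" "(s, t) \<in> r k"
  shows "\<phi> (z(i := x', k := s)) - \<phi> (z(i := x, k := s))
       \<le> \<phi> (z(i := x', k := t)) - \<phi> (z(i := x, k := t))"
  using assms unfolding increasing_differences_prod_def increasing_differences_def monotone_on_def
  by fastforce

text \<open>Pass from \<open>z\<close> to \<open>z'\<close> one coordinate at a time: each change
  raises a single coordinate other than \<open>i\<close>, so increasing differences in that pair
  apply. The entries of \<open>z\<close> and \<open>z'\<close> at \<open>i\<close> are overwritten
  and need not be comparable.\<close>

lemma increasing_differences_prod_increment_mono:
  assumes \<phi>: "increasing_differences_prod d U r \<phi>"
    and i: "i \<in> {1..d}"
    and z: "z \<in> (\<Pi>\<^sub>E i\<in>{1..d}. U i)" and z': "z' \<in> (\<Pi>\<^sub>E i\<in>{1..d}. U i)"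
    and le: "\<And>k. k \<in> {1..d} \<Longrightarrow> k \<noteq> i \<Longrightarrow> (z k, z' k) \<in> r k"
    and x: "x \<in> U i" "x' \<in> U i" "(x, x') \<in> r i"
  shows "\<phi> (z(i := x')) - \<phi> (z(i := x)) \<le> \<phi> (z'(i := x')) - \<phi> (z'(i := x))"
proof -
  \<comment> \<open>The hybrid \<open>override_on z z' S\<close> has the coordinates in
    \<open>S\<close> already raised to those of \<open>z'\<close>; induction on \<open>S\<close>
    raises one more.\<close>
  have "\<phi> (z(i := x')) - \<phi> (z(i := x))
      \<le> \<phi> ((override_on z z' S)(i := x')) - \<phi> ((override_on z z' S)(i := x))"
    if "finite S" "S \<subseteq> {1..d} - {i}" for S
    using that
  proof (induction S rule: finite_induct)
    case (insert k S)
    let ?o = "override_on z z' S"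
    have k: "k \<in> {1..d}" "i \<noteq> k" using insert.prems by auto
    have o: "?o \<in> (\<Pi>\<^sub>E i\<in>{1..d}. U i)"
      using z z' by (auto simp: PiE_iff override_on_def extensional_def)
    have ok: "?o(i := y, k := z k) = ?o(i := y)" for y
      using insert.hyps k by (auto simp: override_on_def)
    have ok': "?o(i := y, k := z' k) = (override_on z z' (insert k S))(i := y)" for y
      using k by (auto simp: override_on_def)
    have "z k \<in> U k" "z' k \<in> U k" using z z' k by (auto simp: PiE_iff)
    from increasing_differences_prodD[OF \<phi> i k(1) k(2) o x this le[OF k(1) k(2)[symmetric]]]
    have "\<phi> (?o(i := x')) - \<phi> (?o(i := x))
        \<le> \<phi> ((override_on z z' (insert k S))(i := x')) - \<phi> ((override_on z z' (insert k S))(i := x))"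
      unfolding ok ok' .
    with insert.IH insert.prems show ?case by (meson insert_subset order_trans)
  qed simp
  from this[of "{1..d} - {i}"]
  have *: "\<phi> (z(i := x')) - \<phi> (z(i := x))
      \<le> \<phi> ((override_on z z' ({1..d} - {i}))(i := x')) - \<phi> ((override_on z z' ({1..d} - {i}))(i := x))"
    by simp
  \<comment> \<open>Outside \<open>{1..d}\<close> both points are \<open>undefined\<close> by
    extensionality, and at \<open>i\<close> both are \<open>y\<close>.\<close>
  have "(override_on z z' ({1..d} - {i}))(i := y) = z'(i := y)" for y
    using z z' by (auto simp: override_on_def PiE_iff extensional_def fun_eq_iff)
  with * show ?thesis by simp
qed

text \<open>Connects the recursion for the staircase with the counting condition on direction
  vectors; its endpoint and its bound by \<open>n\<close> follow.\<close>

lemma staircase_eq_card: "staircase \<omega> t i = card {s \<in> {1..t}. \<omega> s = i}"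
proof (induction t)
  case (Suc t)
  have "{s \<in> {1..Suc t}. \<omega> s = i}
      = (if \<omega> (Suc t) = i then insert (Suc t) {s \<in> {1..t}. \<omega> s = i} else {s \<in> {1..t}. \<omega> s = i})"
    by (auto simp: le_Suc_eq)
  then show ?case using Suc by auto
qed simp

lemma staircase_end:
  assumes "direction_vector d n \<omega>" "i \<in> {1..d}"
  shows "staircase \<omega> (d * n) i = n"
  using assms by (simp add: staircase_eq_card direction_vector_def)

lemma staircase_le:
  assumes "direction_vector d n \<omega>" "i \<in> {1..d}" "t \<le> d * n"
  shows "staircase \<omega> t i \<le> n"
proof -
  have "staircase \<omega> t i \<le> staircase \<omega> (d * n) i"
    unfolding staircase_eq_card using assms(3) by (intro card_mono) auto
  then show ?thesis using staircase_end[OF assms(1,2)] by simp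
qed

lemma grid_point_update_block:
  "i \<in> {1..d} \<Longrightarrow> grid_point d (v(i := w)) p = (grid_point d v p)(i := w (p i))"
  by (auto simp: grid_point_def)

lemma grid_point_update_index:
  "i \<in> {1..d} \<Longrightarrow> grid_point d v (p(i := j)) = (grid_point d v p)(i := v i j)"
  by (auto simp: grid_point_def)

lemma grid_point_in_PiE:
  assumes "\<And>i. i \<in> {1..d} \<Longrightarrow> v i (p i) \<in> U i"
  shows "grid_point d v p \<in> (\<Pi>\<^sub>E i\<in>{1..d}. U i)"
  using assms by (auto simp: grid_point_def)

text \<open>Stated for a unit step from an arbitrary grid point \<open>p\<close>, so that no
  direction vector is involved; the first bracket on the right is the summand that such a step
  contributes to the bound.\<close>

lemma potential_step:
  fixes d :: nat and p :: "nat \<Rightarrow> nat" and \<upsilon> \<alpha> w :: "nat \<Rightarrow> nat \<Rightarrow> 'a"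
  defines "E \<equiv> \<lambda>\<phi> p. \<Sum>i\<in>{1..d}. \<phi> (grid_point d (\<alpha>(i := w i)) p) - \<phi> (grid_point d (\<alpha>(i := \<upsilon> i)) p)"
  assumes po: "\<And>i. i \<in> {1..d} \<Longrightarrow> partial_order_on (U i) (r i)"
    and \<phi>: "increasing_differences_prod d U r \<phi>"
    and U: "\<And>i j. i \<in> {1..d} \<Longrightarrow> j \<le> n \<Longrightarrow> \<upsilon> i j \<in> U i \<and> w i j \<in> U i \<and> \<alpha> i j \<in> U i"
    and \<alpha>: "\<And>i j. i \<in> {1..d} \<Longrightarrow> j < n \<Longrightarrow> (\<alpha> i j, \<alpha> i (Suc j)) \<in> r i"
    and w: "\<And>i j. i \<in> {1..d} \<Longrightarrow> j < n \<Longrightarrow> (w i j, w i (Suc j)) \<in> r i"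
    and \<upsilon>w: "\<And>i j. i \<in> {1..d} \<Longrightarrow> j \<le> n \<Longrightarrow> (\<upsilon> i j, w i j) \<in> r i"
    and w\<alpha>: "\<And>i j. i \<in> {1..d} \<Longrightarrow> j \<le> n \<Longrightarrow> (w i j, \<alpha> i j) \<in> r i"
    and p: "\<And>i. i \<in> {1..d} \<Longrightarrow> p i \<le> n"
    and k: "k \<in> {1..d}" "p k < n"
  shows "\<phi> (grid_point d w (p(k := Suc (p k)))) - \<phi> (grid_point d w p)
    \<le> (\<phi> (grid_point d (\<alpha>(k := \<upsilon> k)) (p(k := Suc (p k)))) - \<phi> (grid_point d (\<alpha>(k := \<upsilon> k)) p))
      + (E \<phi> (p(k := Suc (p k))) - E \<phi> p)"
proof -
  let ?q = "p(k := Suc (p k))"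
  let ?D = "\<lambda>i p. \<phi> (grid_point d (\<alpha>(i := w i)) p) - \<phi> (grid_point d (\<alpha>(i := \<upsilon> i)) p)"
  have q: "?q i \<le> n" if "i \<in> {1..d}" for i using p[OF that] k by auto
  have in_U: "grid_point d w p \<in> Pi\<^sub>E {1..d} U" "grid_point d \<alpha> p \<in> Pi\<^sub>E {1..d} U"
      "grid_point d \<alpha> ?q \<in> Pi\<^sub>E {1..d} U"
    using U p q by (intro grid_point_in_PiE; blast)+
  have id: "(grid_point d w p)(k := w k (p k)) = grid_point d w p"
    using k by (auto simp: grid_point_def)
  have wk: "w k (p k) \<in> U k" "w k (Suc (p k)) \<in> U k" using U k by auto
  have "\<phi> ((grid_point d w p)(k := w k (Suc (p k)))) - \<phi> ((grid_point d w p)(k := w k (p k)))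
      \<le> \<phi> ((grid_point d \<alpha> p)(k := w k (Suc (p k)))) - \<phi> ((grid_point d \<alpha> p)(k := w k (p k)))"
    using w\<alpha> p by (intro increasing_differences_prod_increment_mono[OF \<phi> k(1) in_U(1,2) _ wk w[OF k]])
      (auto simp: grid_point_def)
  then have replace: "\<phi> (grid_point d w ?q) - \<phi> (grid_point d w p)
      \<le> \<phi> (grid_point d (\<alpha>(k := w k)) ?q) - \<phi> (grid_point d (\<alpha>(k := w k)) p)"
    using k by (simp add: grid_point_update_block grid_point_update_index id)
  \<comment> \<open>The step leaves index \<open>i\<close> alone, so both sides compare the same
    pair \<open>\<upsilon> i (p i)\<close>, \<open>w i (p i)\<close>; only the surrounding point
    changes, from \<open>\<alpha> k (p k)\<close> to \<open>\<alpha> k (Suc (p k))\<close> in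
    coordinate \<open>k\<close>.\<close>
  have others: "?D i p \<le> ?D i ?q" if i: "i \<in> {1..d}" "i \<noteq> k" for i
  proof -
    have step: "(grid_point d \<alpha> p j, grid_point d \<alpha> ?q j) \<in> r j" if j: "j \<in> {1..d}" for j
    proof (cases "j = k")
      case False
      then show ?thesis using po[OF j] U[OF j p[OF j]] j
        by (auto simp: grid_point_def partial_order_on_def preorder_on_def refl_on_def)
    qed (use \<alpha>[OF k] j in \<open>auto simp: grid_point_def\<close>)
    have "\<upsilon> i (p i) \<in> U i" "w i (p i) \<in> U i" using U p i by auto
    from increasing_differences_prod_increment_mono[OF \<phi> i(1) in_U(2,3) step this \<upsilon>w[OF i(1) p[OF i(1)]]]
    show ?thesis using i by (simp add: grid_point_update_block)
  qed
  have "?D k ?q - ?D k p + (\<Sum>i\<in>{1..d} - {k}. ?D i p) \<le> ?D k ?q - ?D k p + (\<Sum>i\<in>{1..d} - {k}. ?D i ?q)"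
    by (intro add_left_mono sum_mono) (use others in blast)
  moreover have "E \<phi> p' = ?D k p' + (\<Sum>i\<in>{1..d} - {k}. ?D i p')" for p'
    unfolding E_def by (intro sum.remove) (use k in auto)
  ultimately have "?D k ?q - ?D k p \<le> E \<phi> ?q - E \<phi> p" by simp
  with replace show ?thesis by linarith
qed

theorem theorem2p3:
  fixes d n :: nat
    and \<Upsilon> :: "nat \<Rightarrow> 'a set"
    and r :: "nat \<Rightarrow> 'a rel"
    and \<phi> :: "(nat \<Rightarrow> 'a) \<Rightarrow> real"
    and \<upsilon> \<alpha> :: "nat \<Rightarrow> nat \<Rightarrow> 'a"
    and \<omega> :: "nat \<Rightarrow> nat"
  assumes "\<forall>i\<in>{1..d}. partial_order_on (\<Upsilon> i) (r i)"
    and "increasing_differences_prod d \<Upsilon> r \<phi>"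
    and "\<forall>i\<in>{1..d}. \<forall>j\<in>{0..n}. \<upsilon> i j \<in> \<Upsilon> i \<and> \<alpha> i j \<in> \<Upsilon> i"
    and "\<forall>i\<in>{1..d}. \<forall>j<n. (\<alpha> i j, \<alpha> i (Suc j)) \<in> r i"
    and "\<forall>i\<in>{1..d}. \<upsilon> i 0 = \<alpha> i 0"
    and "\<forall>i\<in>{1..d}. \<forall>j\<in>{1..n}. (\<upsilon> i j, \<upsilon> i n) \<in> r i \<and> (\<upsilon> i j, \<alpha> i j) \<in> r i"
    and "\<forall>i\<in>{1..d}. \<exists>\<upsilon>'.
           (\<forall>j\<in>{0..n}. \<upsilon>' j \<in> \<Upsilon> i) \<and>
           (\<forall>j<n. (\<upsilon>' j, \<upsilon>' (Suc j)) \<in> r i) \<and>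
           \<upsilon>' n = \<upsilon> i n \<and>
           (\<forall>j\<in>{0..n}. (\<upsilon> i j, \<upsilon>' j) \<in> r i \<and> (\<upsilon>' j, \<alpha> i j) \<in> r i)"
    and "direction_vector d n \<omega>"
  shows "\<phi> (\<lambda>i\<in>{1..d}. \<upsilon> i n) \<le> staircase_bound d n \<omega> \<phi> \<upsilon> \<alpha>"
proof -
  from bchoice[OF assms(7)] obtain w where w: "\<forall>i\<in>{1..d}. (\<forall>j\<in>{0..n}. w i j \<in> \<Upsilon> i) \<and>
      (\<forall>j<n. (w i j, w i (Suc j)) \<in> r i) \<and> w i n = \<upsilon> i n \<and>
      (\<forall>j\<in>{0..n}. (\<upsilon> i j, w i j) \<in> r i \<and> (w i j, \<alpha> i j) \<in> r i)" ..
  have w_end: "w i n = \<upsilon> i n" if "i \<in> {1..d}" for i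
    using bspec[OF w that] by blast
  have w_between: "(\<upsilon> i j, w i j) \<in> r i" "(w i j, \<alpha> i j) \<in> r i" if "i \<in> {1..d}" "j \<le> n" for i j
    using bspec[OF w that(1)] that(2) by auto
  \<comment> \<open>Antisymmetry: \<open>w i 0\<close> is squeezed between
    \<open>\<upsilon> i 0\<close> and \<open>\<alpha> i 0\<close>, which are equal.\<close>
  have w0: "w i 0 = \<alpha> i 0" if i: "i \<in> {1..d}" for i
  proof -
    have "(\<alpha> i 0, w i 0) \<in> r i" using w_between(1)[OF i, of 0] bspec[OF assms(5) i] by simp
    moreover have "antisym (r i)" using bspec[OF assms(1) i] by (simp add: partial_order_on_def)
    ultimately show ?thesis using w_between(2)[OF i, of 0] by (meson antisymD zero_le)
  qed
  let ?p = "staircase \<omega>"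
  let ?g = "\<lambda>v p. \<phi> (grid_point d v p)"
  define E where "E = (\<lambda>p. \<Sum>i\<in>{1..d}. ?g (\<alpha>(i := w i)) p - ?g (\<alpha>(i := \<upsilon> i)) p)"
  define B where "B = (\<lambda>t. \<phi> (\<lambda>i\<in>{1..d}. \<alpha> i 0) +
    (\<Sum>s = 1..t. ?g (\<alpha>(\<omega> s := \<upsilon> (\<omega> s))) (?p s) - ?g (\<alpha>(\<omega> s := \<upsilon> (\<omega> s))) (?p (s - 1))))"
  have main: "?g w (?p t) \<le> B t + E (?p t)" if "t \<le> d * n" for t
    using that
  proof (induction t)
    case 0
    have "grid_point d w (?p 0) = (\<lambda>i\<in>{1..d}. \<alpha> i 0)"
      using w0 by (auto simp: grid_point_def)
    \<comment> \<open>At the origin \<open>\<upsilon>\<close>, \<open>w\<close> and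
      \<open>\<alpha>\<close> agree in every block.\<close>
    moreover have "E (?p 0) = 0"
      using w0 assms(5) by (simp add: E_def grid_point_update_block)
    ultimately show ?case by (simp add: B_def del: restrict_apply)
  next
    case (Suc t)
    let ?k = "\<omega> (Suc t)"
    have k: "?k \<in> {1..d}"
      using assms(8) Suc.prems unfolding direction_vector_def by (auto simp: PiE_iff)
    \<comment> \<open>Strict because the next point, one larger in coordinate \<open>?k\<close>,
      still lies in the grid.\<close>
    have "?p t ?k < n"
      using staircase_le[OF assms(8) k Suc.prems] by simp
    moreover have "?p t i \<le> n" if "i \<in> {1..d}" for i
      using staircase_le[OF assms(8) that] Suc.prems by simp
    ultimately have "?g w (?p (Suc t)) - ?g w (?p t)
        \<le> (?g (\<alpha>(?k := \<upsilon> ?k)) (?p (Suc t)) - ?g (\<alpha>(?k := \<upsilon> ?k)) (?p t))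
          + (E (?p (Suc t)) - E (?p t))"
      unfolding E_def using potential_step[where p = "?p t" and k = ?k and w = w and \<upsilon> = \<upsilon> and \<alpha> = \<alpha> and n = n
          and U = \<Upsilon> and r = r and d = d and \<phi> = \<phi>] assms(1-4) w w_between k by simp
    moreover have "B (Suc t) = B t + (?g (\<alpha>(?k := \<upsilon> ?k)) (?p (Suc t)) - ?g (\<alpha>(?k := \<upsilon> ?k)) (?p t))"
      unfolding B_def by (simp del: staircase.simps)
    ultimately show ?case using Suc.IH Suc.prems by linarith
  qed
  \<comment> \<open>The staircase ends at index \<open>n\<close> in every coordinate, where
    \<open>w\<close> and \<open>\<upsilon>\<close> agree, so each summand cancels.\<close>
  have "E (?p (d * n)) = 0"
    using w_end staircase_end[OF assms(8)] by (simp add: E_def grid_point_update_block)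
  moreover have "grid_point d w (?p (d * n)) = (\<lambda>i\<in>{1..d}. \<upsilon> i n)"
    using w_end staircase_end[OF assms(8)] by (auto simp: grid_point_def)
  ultimately show ?thesis
    using main[of "d * n"] by (simp add: B_def staircase_bound_def del: restrict_apply)
qed

end
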